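(* For every integer $d\ge2$: (1) $\mathcal{VC}_{V_d}(V_{[0,1/d)})=\mathcal C_{V_d}(V_{[0,1/d)})=V_{[1/d,1]}$; (2) $\mathcal{VC}_{V_d}(V_{[1/d,1]})=\mathcal C_{V_d}(V_{[1/d,1]})=V_{[0,1/d)}$; (3) $\mathcal{VC}_{T_d}(T_{[0,1/d)})=\mathcal C_{T_d}(T_{[0,1/d)})=T_{[1/d,1]}$; (4) $\mathcal{VC}_{T_d}(T_{[1/d,1]})=\mathcal C_{T_d}(T_{[1/d,1]})=T_{[0,1/d)}$. In particular $(L(V_{[0,1/d)})'\cap L(V_d))'\cap L(V_d)=L(V_{[0,1/d)})$ and $(L(T_{[0,1/d)})'\cap L(T_d))'\cap L(T_d)=L(T_{[0,1/d)})$.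
   Context: $V_d$ is the Higman–Thompson group of piecewise affine bijections of $[0,1)$ with finitely many $d$-adic breakpoints and slopes powers of $d$; $T_d$ its subgroup of elements inducing circle homeomorphisms. $V_{[0,1/d)}$ (resp. $V_{[1/d,1]}$) is the subgroup of $V_d$ of elements acting as the identity on $[0,1/d)$ (resp. on $[1/d,1)$); $T_{[0,1/d)}$, $T_{[1/d,1]}$ are defined likewise in $T_d$. For $H\le G$: $\mathcal C_G(H)=\{g\in G:h^{-1}gh=g\ \forall h\in H\}$ and the virtual centralizer $\mathcal{VC}_G(H)=\{g\in G:\{h^{-1}gh:h\in H\}\text{ is finite}\}$. For $A\subseteq L(G)$, $A'\cap L(G)$ is the relative commutant. *)

theory Defs
  imports Complex_Main "HOL-Algebra.Group"
begin

definition dadic :: "nat \<Rightarrow> real set" where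
  "dadic d = {of_int m / (real d) ^ k | m k. True}"

text \<open>Elements of the Higman--Thompson group V_d, realised as maps real to real
  which are bijections of [0,1) and the identity outside [0,1).  Pieces are
  half-open intervals [a_i, a_(i+1)) with d-adic breakpoints, on which f is affine
  with slope a (possibly negative) integer power of d.\<close>
definition HT_V :: "nat \<Rightarrow> (real \<Rightarrow> real) set" where
  "HT_V d = {f. bij_betw f {0..<1} {0..<1} \<and> (\<forall>x. x \<notin> {0..<1} \<longrightarrow> f x = x) \<and>
     (\<exists>(a :: nat \<Rightarrow> real) (n :: nat) (k :: nat \<Rightarrow> int) (b :: nat \<Rightarrow> real).
        a 0 = 0 \<and> a n = 1 \<and> (\<forall>i<n. a i < a (Suc i)) \<and> (\<forall>i\<le>n. a i \<in> dadic d) \<and>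
        (\<forall>i<n. \<forall>x\<in>{a i..<a (Suc i)}. f x = (real d) powi (k i) * x + b i))}"

text \<open>T_d: elements of V_d inducing homeomorphisms of the circle R/Z, i.e. the
  induced map on the circle (via t \<mapsto> exp(2 pi i t)) is continuous.\<close>
definition HT_T :: "nat \<Rightarrow> (real \<Rightarrow> real) set" where
  "HT_T d = {f \<in> HT_V d. continuous_on UNIV (\<lambda>x. cis (2 * pi * f (frac x)))}"

definition Vgrp :: "nat \<Rightarrow> (real \<Rightarrow> real) monoid" where
  "Vgrp d = \<lparr>carrier = HT_V d, mult = (\<circ>), one = id\<rparr>"

definition Tgrp :: "nat \<Rightarrow> (real \<Rightarrow> real) monoid" where
  "Tgrp d = \<lparr>carrier = HT_T d, mult = (\<circ>), one = id\<rparr>"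

definition fix_on :: "(real \<Rightarrow> real) set \<Rightarrow> real set \<Rightarrow> (real \<Rightarrow> real) set" where
  "fix_on G S = {g \<in> G. \<forall>x\<in>S. g x = x}"

definition centralizer :: "('a, 'b) monoid_scheme \<Rightarrow> 'a set \<Rightarrow> 'a set" where
  "centralizer G H = {g \<in> carrier G. \<forall>h\<in>H. inv\<^bsub>G\<^esub> h \<otimes>\<^bsub>G\<^esub> g \<otimes>\<^bsub>G\<^esub> h = g}"

definition virtual_centralizer :: "('a, 'b) monoid_scheme \<Rightarrow> 'a set \<Rightarrow> 'a set" where
  "virtual_centralizer G H =
     {g \<in> carrier G. finite {inv\<^bsub>G\<^esub> h \<otimes>\<^bsub>G\<^esub> g \<otimes>\<^bsub>G\<^esub> h | h. h \<in> H}}"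

end

theory Submission
  imports Defs "HOL-Analysis.Analysis"
begin

(* Elements with disjoint supports commute, so every element fixing J = [1/d,1) (resp. [0,1/d))
   centralizes the subgroup H of elements fixing the complementary piece A. Conversely, if g has
   only finitely many H-conjugates but moves a point of J = [a,b), then, being piecewise affine,
   g moves a point x of (a,b). Piecewise-linear bumps F_n in T_d supported in (a,b), whose
   inverses therefore lie in H, can be chosen to fix one of x, g x and to move the other one
   (whichever lies in (a,b)) to infinitely many distinct places; then the conjugates
   F_n g F_n^-1 are pairwise distinct. That V_d and T_d are closed under inverses needs the
   images of the affine pieces to be re-sorted into a d-adic partition. *)

section \<open>d-adic rationals\<close>

lemma dadic_divide_power: "real_of_int m / real d ^ k \<in> dadic d"
  unfolding dadic_def by blast

lemma dadic_of_int [simp]: "real_of_int m \<in> dadic d"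
  using dadic_divide_power[of m d 0] by simp

lemma dadic_0 [simp]: "0 \<in> dadic d" and dadic_1 [simp]: "1 \<in> dadic d"
  using dadic_of_int[of 0 d] dadic_of_int[of 1 d] by simp_all

lemma dadic_add:
  assumes "0 < d" "x \<in> dadic d" "y \<in> dadic d" shows "x + y \<in> dadic d"
proof -
  obtain m k m' k' where x: "x = of_int m / real d ^ k" and y: "y = of_int m' / real d ^ k'"
    using assms(2,3) unfolding dadic_def by blast
  have "x + y = of_int (m * int d ^ k' + m' * int d ^ k) / real d ^ (k + k')"
    using assms(1) by (simp add: x y field_simps power_add)
  then show ?thesis unfolding dadic_def by blast
qed

lemma dadic_uminus: "x \<in> dadic d \<Longrightarrow> - x \<in> dadic d"
proof -
  assume "x \<in> dadic d"
  then obtain m k where "x = of_int m / real d ^ k" unfolding dadic_def by blast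
  then have "- x = of_int (- m) / real d ^ k" by simp
  then show ?thesis unfolding dadic_def by blast
qed

lemma dadic_diff: "0 < d \<Longrightarrow> x \<in> dadic d \<Longrightarrow> y \<in> dadic d \<Longrightarrow> x - y \<in> dadic d"
  using dadic_add[of d x "- y"] dadic_uminus[of y d] by simp

lemma dadic_powi_mult:
  assumes "0 < d" "x \<in> dadic d" shows "real d powi j * x \<in> dadic d"
proof -
  obtain m k where x: "x = of_int m / real d ^ k" using assms(2) unfolding dadic_def by blast
  show ?thesis
  proof (cases "0 \<le> j")
    case True
    then have "real d powi j * x = of_int (m * int d ^ nat j) / real d ^ k"
      by (simp add: x power_int_def)
    then show ?thesis unfolding dadic_def by blast
  next
    case False
    then have "real d powi j * x = of_int m / real d ^ (k + nat (- j))"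
      using assms(1) by (simp add: x power_int_def power_add field_simps)
    then show ?thesis unfolding dadic_def by blast
  qed
qed

lemma dadic_divide: "0 < d \<Longrightarrow> x \<in> dadic d \<Longrightarrow> x / real d \<in> dadic d"
  using dadic_powi_mult[of d x "- 1"] by (simp add: power_int_minus divide_inverse mult.commute)

section \<open>Partitions of the unit interval\<close>

lemma breakpoints_less:
  fixes a :: "nat \<Rightarrow> 'a::linorder"
  assumes "\<forall>i<n. a i < a (Suc i)" "i < j" "j \<le> n" shows "a i < a j"
  using assms(2,3)
proof (induction j)
  case (Suc j)
  have "a j < a (Suc j)" using assms(1) Suc.prems(2) by simp
  then show ?case using Suc by (auto simp: less_Suc_eq)
qed simp

lemma breakpoints_le:
  fixes a :: "nat \<Rightarrow> 'a::linorder"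
  assumes "\<forall>i<n. a i < a (Suc i)" "i \<le> j" "j \<le> n" shows "a i \<le> a j"
  using breakpoints_less[OF assms(1), of i j] assms(2,3) by (cases "i = j") auto

lemma piece_exists:
  fixes a :: "nat \<Rightarrow> 'a::linorder"
  assumes "a 0 \<le> x" "x < a n" shows "\<exists>i<n. a i \<le> x \<and> x < a (Suc i)"
  using assms(2)
proof (induction n)
  case (Suc n)
  then show ?case by (cases "x < a n") (auto simp: not_less less_Suc_eq)
qed (use assms(1) in simp)

lemma piece_unique:
  fixes a :: "nat \<Rightarrow> 'a::linorder"
  assumes "\<forall>i<n. a i < a (Suc i)" "i < n" "j < n"
    and "x \<in> {a i..<a (Suc i)}" "x \<in> {a j..<a (Suc j)}"
  shows "i = j"
proof (rule ccontr)
  assume "i \<noteq> j"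
  then consider "Suc i \<le> j" | "Suc j \<le> i" by linarith
  then show False
    by cases (use breakpoints_le[OF assms(1)] assms(2-5) in \<open>force+\<close>)
qed

lemma UN_pieces:
  fixes a :: "nat \<Rightarrow> 'a::linorder"
  assumes "\<forall>i<n. a i < a (Suc i)" shows "(\<Union>i<n. {a i..<a (Suc i)}) = {a 0..<a n}"
proof
  show "(\<Union>i<n. {a i..<a (Suc i)}) \<subseteq> {a 0..<a n}"
  proof clarify
    fix i x assume "i < n" "x \<in> {a i..<a (Suc i)}"
    moreover have "a 0 \<le> a i" "a (Suc i) \<le> a n"
      using breakpoints_le[OF assms] \<open>i < n\<close> by simp_all
    ultimately show "x \<in> {a 0..<a n}" by auto
  qed
  show "{a 0..<a n} \<subseteq> (\<Union>i<n. {a i..<a (Suc i)})"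
    using piece_exists[of a _ n] by force
qed

lemma strict_enumeration:
  fixes B :: "'a::linorder set"
  assumes "finite B" "B \<noteq> {}"
  obtains c m where "\<forall>j<m. c j < c (Suc j)" "c ` {..m} = B"
proof -
  define xs where "xs = sorted_list_of_set B"
  have sorted: "sorted_wrt (<) xs" and set: "set xs = B"
    using assms(1) unfolding xs_def by simp_all
  then obtain m where len: "length xs = Suc m" using assms(2) by (cases xs) auto
  have "(!) xs ` {..m} = set xs"
    by (simp add: len lessThan_Suc_atMost[symmetric] image_def set_conv_nth) blast
  then show ?thesis
    by (intro that[where c = "(!) xs" and m = m]) (use sorted len set in \<open>simp_all add: sorted_wrt_nth_less\<close>)
qed

lemma image_affinity_atLeastLessThan:
  fixes m :: "'a::linordered_field"
  assumes "0 < m" shows "(\<lambda>x. m * x + c) ` {a..<b} = {m * a + c..<m * b + c}"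
proof
  show "(\<lambda>x. m * x + c) ` {a..<b} \<subseteq> {m * a + c..<m * b + c}"
    using assms by auto
  show "{m * a + c..<m * b + c} \<subseteq> (\<lambda>x. m * x + c) ` {a..<b}"
  proof
    fix y assume "y \<in> {m * a + c..<m * b + c}"
    then have "(y - c) / m \<in> {a..<b}" and "y = m * ((y - c) / m) + c"
      using assms by (auto simp: field_simps)
    then show "y \<in> (\<lambda>x. m * x + c) ` {a..<b}" by blast
  qed
qed

context
  fixes n :: nat and l r :: "nat \<Rightarrow> real"
  assumes lr: "\<forall>i<n. l i < r i" and cover: "(\<Union>i<n. {l i..<r i}) = {0..<1}"
    and disjoint: "\<And>i i'. i < n \<Longrightarrow> i' < n \<Longrightarrow> i \<noteq> i' \<Longrightarrow> {l i..<r i} \<inter> {l i'..<r i'} = {}"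
begin

lemma interval_cover_bounds:
  assumes "i < n" shows "0 \<le> l i" "l i < 1" "r i \<le> 1"
proof -
  have sub: "{l i..<r i} \<subseteq> {0..<1}" using cover \<open>i < n\<close> by blast
  then show "0 \<le> l i" "l i < 1" using lr \<open>i < n\<close> by auto
  show "r i \<le> 1"
  proof (rule ccontr)
    assume "\<not> r i \<le> 1"
    then have "1 \<in> {l i..<r i}" using \<open>l i < 1\<close> by simp
    then show False using sub by auto
  qed
qed

lemma interval_cover_next:
  fixes c :: "nat \<Rightarrow> real"
  assumes c_mono: "\<forall>j<m. c j < c (Suc j)" and c_img: "c ` {..m} = l ` {..<n} \<union> {1}"
    and "j < m" "i < n" "l i = c j"
  shows "r i = c (Suc j)"
proof (rule antisym)
  note bounds = interval_cover_bounds
  have c_less: "c j < c (Suc j)" using c_mono \<open>j < m\<close> by simp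
  have cB: "c (Suc j) \<in> l ` {..<n} \<union> {1}" using c_img \<open>j < m\<close> by auto
  show "r i \<le> c (Suc j)"
  proof (rule ccontr)
    assume "\<not> r i \<le> c (Suc j)"
    then have in_i: "c (Suc j) \<in> {l i..<r i}" using c_less \<open>l i = c j\<close> by simp
    then have "c (Suc j) \<in> {0..<1}" using cover \<open>i < n\<close> by blast
    then have "c (Suc j) \<noteq> 1" by simp
    then obtain i' where "i' < n" "l i' = c (Suc j)" using cB by auto
    moreover have "c (Suc j) \<in> {l i'..<r i'}" using lr calculation by auto
    moreover have "i' \<noteq> i" using c_less calculation(2) \<open>l i = c j\<close> by auto
    ultimately show False using disjoint[OF \<open>i < n\<close>] in_i by blast
  qed
  show "c (Suc j) \<le> r i"
  proof (rule ccontr)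
    assume "\<not> c (Suc j) \<le> r i"
    moreover have "c (Suc j) \<le> 1" using cB bounds(2) by (auto simp: less_imp_le)
    moreover have "0 \<le> r i" using bounds(1)[OF \<open>i < n\<close>] lr \<open>i < n\<close> by force
    ultimately have "r i \<in> {0..<1}" by simp
    then obtain i' where i': "i' < n" "r i \<in> {l i'..<r i'}" using cover by blast
    have "l i' \<in> c ` {..m}" using c_img i'(1) by auto
    then obtain k where k: "k \<le> m" "c k = l i'" by auto
    have "c k < c (Suc j)" using k i' \<open>\<not> c (Suc j) \<le> r i\<close> by simp
    then have "k \<le> j" using breakpoints_le[OF c_mono, of "Suc j" k] k(1) by (meson not_less not_less_eq_eq)
    then have "l i' \<le> l i" using breakpoints_le[OF c_mono, of k j] \<open>j < m\<close> k \<open>l i = c j\<close> by simp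
    then have "l i \<in> {l i'..<r i'}" using i' lr \<open>i < n\<close> by auto
    moreover have "l i \<in> {l i..<r i}" using lr \<open>i < n\<close> by simp
    ultimately have "i' = i" using disjoint[OF i'(1) \<open>i < n\<close>] by blast
    then show False using i'(2) by simp
  qed
qed

lemma interval_cover_sorted:
  obtains c m \<sigma> where "c 0 = 0" "c m = 1" "\<forall>j<m. c j < c (Suc j)"
    "\<forall>j<m. \<sigma> j < n \<and> l (\<sigma> j) = c j \<and> r (\<sigma> j) = c (Suc j)"
proof -
  note bounds = interval_cover_bounds
  define B where "B = l ` {..<n} \<union> {1}"
  have "finite B" "B \<noteq> {}" unfolding B_def by auto
  then obtain c m where c_mono: "\<forall>j<m. c j < c (Suc j)" and c_img: "c ` {..m} = B"
    by (rule strict_enumeration)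
  have B_01: "B \<subseteq> {0..1}" using bounds unfolding B_def by force
  have "0 \<in> B"
  proof -
    have "0 \<in> (\<Union>i<n. {l i..<r i})" using cover by simp
    then obtain i where "i < n" "0 \<in> {l i..<r i}" by blast
    then show ?thesis using bounds(1)[of i] unfolding B_def by force
  qed
  then obtain j where "j \<le> m" "c j = 0" using c_img by auto
  moreover have "0 \<le> c 0" using B_01 c_img by auto
  ultimately have c_0: "c 0 = 0" using breakpoints_le[OF c_mono, of 0 j] by simp
  have "1 \<in> c ` {..m}" using c_img unfolding B_def by simp
  then obtain j' where "j' \<le> m" "c j' = 1" by auto
  moreover have "c m \<le> 1" using B_01 c_img by auto
  ultimately have c_m: "c m = 1" using breakpoints_le[OF c_mono, of j' m] by simp
  have "\<exists>i<n. l i = c j" if "j < m" for j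
  proof -
    have "c j \<in> B" "c j < 1" using c_img that breakpoints_less[OF c_mono, of j m] c_m by auto
    then show ?thesis unfolding B_def by auto
  qed
  then obtain \<sigma> where \<sigma>: "\<And>j. j < m \<Longrightarrow> \<sigma> j < n \<and> l (\<sigma> j) = c j" by metis
  show ?thesis
  proof (rule that[OF c_0 c_m c_mono], intro allI impI conjI)
    fix j assume "j < m"
    then show "\<sigma> j < n" and "l (\<sigma> j) = c j" using \<sigma> by simp_all
    then show "r (\<sigma> j) = c (Suc j)"
      using interval_cover_next[OF c_mono] c_img \<open>j < m\<close> unfolding B_def by blast
  qed
qed

end

section \<open>Inverses in V_d and T_d\<close>

definition affine_partition ::
    "nat \<Rightarrow> (real \<Rightarrow> real) \<Rightarrow> (nat \<Rightarrow> real) \<Rightarrow> nat \<Rightarrow> (nat \<Rightarrow> int) \<Rightarrow> (nat \<Rightarrow> real) \<Rightarrow> bool" where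
  "affine_partition d f a n k b \<longleftrightarrow> a 0 = 0 \<and> a n = 1 \<and> (\<forall>i<n. a i < a (Suc i)) \<and> (\<forall>i\<le>n. a i \<in> dadic d) \<and>
     (\<forall>i<n. \<forall>x\<in>{a i..<a (Suc i)}. f x = real d powi k i * x + b i)"

lemma HT_V_iff:
  "f \<in> HT_V d \<longleftrightarrow> bij_betw f {0..<1} {0..<1} \<and> (\<forall>x. x \<notin> {0..<1} \<longrightarrow> f x = x) \<and>
     (\<exists>a n k b. affine_partition d f a n k b)"
  unfolding HT_V_def affine_partition_def by simp

lemma affine_partition_of_interval_cover:
  fixes l r :: "nat \<Rightarrow> real"
  assumes "0 < d" and lr: "\<forall>i<n. l i < r i" and cover: "(\<Union>i<n. {l i..<r i}) = {0..<1}"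
    and disjoint: "\<And>i i'. i < n \<Longrightarrow> i' < n \<Longrightarrow> i \<noteq> i' \<Longrightarrow> {l i..<r i} \<inter> {l i'..<r i'} = {}"
    and length: "\<forall>i<n. r i - l i \<in> dadic d"
    and affine: "\<forall>i<n. \<forall>y\<in>{l i..<r i}. g y = real d powi k i * y + b i"
  shows "\<exists>c m k' b'. affine_partition d g c m k' b'"
proof -
  obtain c m \<sigma> where c_0: "c 0 = 0" and c_m: "c m = 1" and c_mono: "\<forall>j<m. c j < c (Suc j)"
    and c_\<sigma>: "\<forall>j<m. \<sigma> j < n \<and> l (\<sigma> j) = c j \<and> r (\<sigma> j) = c (Suc j)"
    using interval_cover_sorted[OF lr cover disjoint] by blast
  have "c j \<in> dadic d" if "j \<le> m" for j
    using that
  proof (induction j)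
    case (Suc j)
    then have "j < m" by simp
    then have \<sigma>: "\<sigma> j < n" "l (\<sigma> j) = c j" "r (\<sigma> j) = c (Suc j)" using c_\<sigma> by auto
    then have "c (Suc j) = c j + (r (\<sigma> j) - l (\<sigma> j))" by simp
    moreover have "r (\<sigma> j) - l (\<sigma> j) \<in> dadic d" using length \<sigma>(1) by blast
    ultimately show ?case using Suc dadic_add[OF \<open>0 < d\<close>] by simp
  qed (simp add: c_0)
  then have "affine_partition d g c m (k \<circ> \<sigma>) (b \<circ> \<sigma>)"
    unfolding affine_partition_def using c_0 c_m c_mono c_\<sigma> affine by auto
  then show ?thesis by blast
qed

lemma bij_of_bij_betw_fixing_compl:
  assumes "bij_betw f S S" "\<forall>x. x \<notin> S \<longrightarrow> f x = x" shows "bij f"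
proof -
  have "bij_betw f (- S) (- S)" using assms(2) bij_betw_id bij_betw_cong[of "- S" f id] by simp
  then have "bij_betw f (S \<union> - S) (S \<union> - S)" using assms(1) by (intro bij_betw_combine) auto
  then show ?thesis by simp
qed

lemma HT_V_bij: "f \<in> HT_V d \<Longrightarrow> bij f"
  unfolding HT_V_iff by (blast intro: bij_of_bij_betw_fixing_compl)

lemma HT_V_fixes_outside: "f \<in> HT_V d \<Longrightarrow> x \<notin> {0..<1} \<Longrightarrow> f x = x"
  unfolding HT_V_iff by blast

lemma inv_into_fixing_compl:
  assumes "bij f" "f ` S = S" "\<forall>x. x \<notin> S \<longrightarrow> f x = x"
  shows "bij_betw (inv_into UNIV f) S S" "\<forall>x. x \<notin> S \<longrightarrow> inv_into UNIV f x = x"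
proof -
  show "bij_betw (inv_into UNIV f) S S"
    by (rule bij_betw_inv_into_subset[OF assms(1) subset_UNIV assms(2)])
  show "\<forall>x. x \<notin> S \<longrightarrow> inv_into UNIV f x = x"
    using assms(3) inv_f_f[OF bij_is_inj[OF assms(1)]] by metis
qed

lemma affine_partition_images:
  assumes "0 < d" "inj f" "f ` {0..<1} = {0..<1}" and part: "affine_partition d f a n k b"
  obtains l r :: "nat \<Rightarrow> real"
  where "\<And>i. i < n \<Longrightarrow> f ` {a i..<a (Suc i)} = {l i..<r i}"
    and "\<forall>i<n. l i < r i" and "(\<Union>i<n. {l i..<r i}) = {0..<1}"
    and "\<And>i i'. i < n \<Longrightarrow> i' < n \<Longrightarrow> i \<noteq> i' \<Longrightarrow> {l i..<r i} \<inter> {l i'..<r i'} = {}"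
    and "\<forall>i<n. r i - l i \<in> dadic d"
proof -
  define l where "l i = real d powi k i * a i + b i" for i
  define r where "r i = real d powi k i * a (Suc i) + b i" for i
  have a_0: "a 0 = 0" and a_n: "a n = 1" and a_mono: "\<forall>i<n. a i < a (Suc i)"
    and a_dadic: "\<forall>i\<le>n. a i \<in> dadic d"
    and f_affine: "\<forall>i<n. \<forall>x\<in>{a i..<a (Suc i)}. f x = real d powi k i * x + b i"
    using part unfolding affine_partition_def by auto
  have slope_pos: "0 < real d powi k i" for i using assms(1) by simp
  have image: "f ` {a i..<a (Suc i)} = {l i..<r i}" if "i < n" for i
  proof -
    have "f ` {a i..<a (Suc i)} = (\<lambda>x. real d powi k i * x + b i) ` {a i..<a (Suc i)}"
      using f_affine that by (auto intro!: image_cong)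
    then show ?thesis by (simp add: image_affinity_atLeastLessThan[OF slope_pos] l_def r_def)
  qed
  have lr: "\<forall>i<n. l i < r i" using a_mono slope_pos by (simp add: l_def r_def)
  have "(\<Union>i<n. {l i..<r i}) = f ` (\<Union>i<n. {a i..<a (Suc i)})" using image by (simp add: image_UN)
  also have "\<dots> = {0..<1}" using assms(3) UN_pieces[OF a_mono] a_0 a_n by simp
  finally have cover: "(\<Union>i<n. {l i..<r i}) = {0..<1}" .
  have disjoint: "{l i..<r i} \<inter> {l i'..<r i'} = {}" if "i < n" "i' < n" "i \<noteq> i'" for i i'
  proof -
    have "{a i..<a (Suc i)} \<inter> {a i'..<a (Suc i')} = {}"
      using piece_unique[OF a_mono that(1,2)] that(3) by blast
    then show ?thesis
      using image_Int[OF assms(2)] image[OF that(1)] image[OF that(2)] by (metis image_empty)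
  qed
  have "r i - l i = real d powi k i * (a (Suc i) - a i)" for i
    by (simp add: l_def r_def algebra_simps)
  then have length: "\<forall>i<n. r i - l i \<in> dadic d"
    using a_dadic dadic_diff[OF assms(1)] dadic_powi_mult[OF assms(1)] by simp
  show ?thesis using image lr cover disjoint length by (rule that)
qed

lemma HT_V_inv:
  assumes d: "0 < d" and f: "f \<in> HT_V d" shows "inv_into UNIV f \<in> HT_V d"
proof -
  have bij: "bij f" using f by (rule HT_V_bij)
  have onto: "f ` {0..<1} = {0..<1}" and outside: "\<forall>x. x \<notin> {0..<1} \<longrightarrow> f x = x"
    using f unfolding HT_V_iff bij_betw_def by blast+
  obtain a n k b where part: "affine_partition d f a n k b" using f unfolding HT_V_iff by blast
  show ?thesis
  proof (rule affine_partition_images[OF d bij_is_inj[OF bij] onto part])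
    fix l r :: "nat \<Rightarrow> real"
    assume image: "\<And>i. i < n \<Longrightarrow> f ` {a i..<a (Suc i)} = {l i..<r i}"
      and cover: "\<forall>i<n. l i < r i" "(\<Union>i<n. {l i..<r i}) = {0..<1}"
        "\<And>i i'. i < n \<Longrightarrow> i' < n \<Longrightarrow> i \<noteq> i' \<Longrightarrow> {l i..<r i} \<inter> {l i'..<r i'} = {}"
        "\<forall>i<n. r i - l i \<in> dadic d"
    define k' where "k' i = - k i" for i
    define b' where "b' i = - b i * real d powi k' i" for i
    have "\<forall>i<n. \<forall>y\<in>{l i..<r i}. inv_into UNIV f y = real d powi k' i * y + b' i"
    proof (intro allI impI ballI)
      fix i y assume "i < n" "y \<in> {l i..<r i}"
      then obtain x where x: "x \<in> {a i..<a (Suc i)}" "y = f x" using image by blast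
      then have "inv_into UNIV f y = x" using bij by (simp add: bij_is_inj)
      moreover have "y = real d powi k i * x + b i"
        using part \<open>i < n\<close> x unfolding affine_partition_def by simp
      ultimately show "inv_into UNIV f y = real d powi k' i * y + b' i"
        using d by (simp add: k'_def b'_def power_int_minus field_simps)
    qed
    then show ?thesis
      using affine_partition_of_interval_cover[OF d cover] inv_into_fixing_compl[OF bij onto outside]
      unfolding HT_V_iff by blast
  qed
qed

definition circle_proj :: "real \<Rightarrow> complex" where
  "circle_proj t = cis (2 * pi * t)"

definition circle_arg :: "complex \<Rightarrow> real" where
  "circle_arg = inv_into {0..<1} circle_proj"

definition circle_map :: "(real \<Rightarrow> real) \<Rightarrow> complex \<Rightarrow> complex" where
  "circle_map f z = circle_proj (f (circle_arg z))"

lemma circle_proj_frac: "circle_proj (frac x) = circle_proj x"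
proof -
  have "circle_proj x = circle_proj (frac x) * cis (2 * pi * of_int \<lfloor>x\<rfloor>)"
    unfolding circle_proj_def cis_mult by (simp add: frac_def algebra_simps)
  then show ?thesis by (simp add: cis_multiple_2pi)
qed

lemma inj_on_circle_proj: "inj_on circle_proj {0..<1}"
proof
  fix a b :: real assume ab: "a \<in> {0..<1}" "b \<in> {0..<1}" "circle_proj a = circle_proj b"
  then have "sin (2 * pi * a) = sin (2 * pi * b) \<and> cos (2 * pi * a) = cos (2 * pi * b)"
    unfolding circle_proj_def by (simp add: complex_eq_iff)
  then obtain n :: int where "2 * pi * a = 2 * pi * b + 2 * pi * n" using sin_cos_eq_iff by blast
  then have "2 * pi * a = 2 * pi * (b + n)" by (simp add: algebra_simps)
  then have "a = b + n" by simp
  moreover from this have "n = 0" using ab(1,2) by simp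
  ultimately show "a = b" by simp
qed

lemma circle_proj_image: "circle_proj ` {0..<1} = sphere 0 1"
proof
  show "circle_proj ` {0..<1} \<subseteq> sphere 0 1" by (auto simp: circle_proj_def)
  show "sphere 0 1 \<subseteq> circle_proj ` {0..<1}"
  proof
    fix z :: complex assume "z \<in> sphere 0 1"
    then have "z \<noteq> 0" "norm z = 1" by auto
    have "circle_proj (frac (Arg z / (2 * pi))) = circle_proj (Arg z / (2 * pi))"
      by (rule circle_proj_frac)
    also have "\<dots> = sgn z" using \<open>z \<noteq> 0\<close> by (simp add: circle_proj_def cis_Arg)
    also have "\<dots> = z" using \<open>norm z = 1\<close> by (simp add: sgn_div_norm)
    finally have "circle_proj (frac (Arg z / (2 * pi))) = z" .
    moreover have "frac (Arg z / (2 * pi)) \<in> {0..<1}" by (simp add: frac_lt_1)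
    ultimately show "z \<in> circle_proj ` {0..<1}" by (metis image_eqI)
  qed
qed

lemma continuous_on_circle_proj: "continuous_on A circle_proj"
  unfolding circle_proj_def by (intro continuous_intros)

lemma circle_arg_proj: "circle_arg (circle_proj x) = frac x"
  using inv_into_f_f[OF inj_on_circle_proj, of "frac x"]
  by (simp add: circle_arg_def circle_proj_frac frac_lt_1)

lemma circle_proj_arg: "z \<in> sphere 0 1 \<Longrightarrow> circle_proj (circle_arg z) = z"
  unfolding circle_arg_def using circle_proj_image by (simp add: f_inv_into_f)

lemma circle_arg_image: "circle_arg ` sphere 0 1 = {0..<1}"
  unfolding circle_arg_def circle_proj_image[symmetric]
  by (rule inv_into_image_cancel[OF inj_on_circle_proj subset_refl])

lemma circle_map_proj: "circle_map f \<circ> circle_proj = (\<lambda>x. cis (2 * pi * f (frac x)))"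
  by (simp add: fun_eq_iff circle_map_def circle_arg_proj) (simp add: circle_proj_def)

lemma quotient_map_circle_proj:
  "quotient_map (top_of_set {0..1}) (top_of_set (sphere 0 1)) circle_proj"
proof (rule continuous_imp_quotient_map)
  show "continuous_map (top_of_set {0..1}) (top_of_set (sphere 0 1)) circle_proj"
    using continuous_on_circle_proj by (simp add: Pi_iff circle_proj_def)
  have "{0..1::real} = insert 1 {0..<1}" by auto
  moreover have "circle_proj 1 = circle_proj 0" using circle_proj_frac[of 1] by simp
  ultimately have "circle_proj ` {0..1} = circle_proj ` {0..<1}" by auto
  then show "circle_proj ` topspace (top_of_set {0..1}) = topspace (top_of_set (sphere 0 1))"
    by (simp add: circle_proj_image)
qed (simp_all add: compact_space_subtopology Hausdorff_space_subtopology)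

lemma continuous_circle_map_iff:
  "continuous_on UNIV (\<lambda>x. cis (2 * pi * f (frac x))) \<longleftrightarrow> continuous_on (sphere 0 1) (circle_map f)"
proof
  assume "continuous_on UNIV (\<lambda>x. cis (2 * pi * f (frac x)))"
  then have "continuous_on {0..1} (circle_map f \<circ> circle_proj)"
    unfolding circle_map_proj by (rule continuous_on_subset) simp
  then have "continuous_map (top_of_set {0..1}) euclidean (circle_map f \<circ> circle_proj)"
    by simp
  then have "continuous_map (top_of_set (sphere 0 1)) euclidean (circle_map f)"
    by (rule continuous_compose_quotient_map[OF quotient_map_circle_proj])
  then show "continuous_on (sphere 0 1) (circle_map f)" by simp
next
  assume "continuous_on (sphere 0 1) (circle_map f)"
  then have "continuous_on UNIV (circle_map f \<circ> circle_proj)"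
    by (rule continuous_on_compose[OF continuous_on_circle_proj continuous_on_subset])
      (auto simp: circle_proj_def)
  then show "continuous_on UNIV (\<lambda>x. cis (2 * pi * f (frac x)))" by (simp add: circle_map_proj)
qed

lemma HT_T_iff: "f \<in> HT_T d \<longleftrightarrow> f \<in> HT_V d \<and> continuous_on (sphere 0 1) (circle_map f)"
  unfolding HT_T_def continuous_circle_map_iff by simp

lemma continuous_circle_map_inv:
  assumes f: "bij_betw f {0..<1} {0..<1}" and cont: "continuous_on (sphere 0 1) (circle_map f)"
    and gf: "\<And>x. x \<in> {0..<1} \<Longrightarrow> g (f x) = x"
  shows "continuous_on (sphere 0 1) (circle_map g)"
proof -
  have "circle_map f ` sphere 0 1 = circle_proj ` f ` circle_arg ` sphere 0 1"
    by (simp add: image_image circle_map_def[abs_def])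
  also have "\<dots> = sphere 0 1"
    using f by (simp add: bij_betw_def circle_arg_image circle_proj_image)
  finally have "circle_map f ` sphere 0 1 = sphere 0 1" .
  moreover have "circle_map g (circle_map f z) = z" if "z \<in> sphere 0 1" for z
  proof -
    have x: "circle_arg z \<in> {0..<1}" using circle_arg_image that by blast
    then have "f (circle_arg z) \<in> {0..<1}" using f by (meson bij_betwE)
    then show ?thesis using x that by (simp add: circle_map_def circle_arg_proj frac_eq gf circle_proj_arg)
  qed
  ultimately show ?thesis using continuous_on_inv[OF cont] by simp
qed

lemma HT_T_inv:
  assumes "0 < d" "f \<in> HT_T d" shows "inv_into UNIV f \<in> HT_T d"
proof -
  have f: "f \<in> HT_V d" "continuous_on (sphere 0 1) (circle_map f)" using assms(2) by (simp_all add: HT_T_iff)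
  have "x \<in> {0..<1} \<Longrightarrow> inv_into UNIV f (f x) = x" for x using HT_V_bij[OF f(1)] by (simp add: bij_is_inj)
  then have "continuous_on (sphere 0 1) (circle_map (inv_into UNIV f))"
    using continuous_circle_map_inv f HT_V_iff by blast
  then show ?thesis using HT_V_inv[OF assms(1) f(1)] by (simp add: HT_T_iff)
qed

section \<open>Bump functions\<close>

text \<open>The map fixing everything outside [u, u + L + L/D], with slope 1/D on [u, u + L] and slope
  D on [u + L, u + L + L/D]; the min/max form makes continuity immediate.\<close>

definition bump :: "real \<Rightarrow> real \<Rightarrow> real \<Rightarrow> real \<Rightarrow> real" where
  "bump D u L x = u + min (x - u) 0 + min (max (x - u) 0) L / D + D * min (max (x - u - L) 0) (L / D)
     + max (x - u - L - L / D) 0"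

context
  fixes D u L :: real
  assumes D: "0 < D" and L: "0 < L"
begin

lemma bump_below: "x \<le> u \<Longrightarrow> bump D u L x = x"
proof -
  assume "x \<le> u"
  then have "min (x - u) 0 = x - u" "min (max (x - u) 0) L = 0" "min (max (x - u - L) 0) (L / D) = 0"
    "max (x - u - L - L / D) 0 = 0" using L divide_pos_pos[OF L D] by (auto simp: min_def max_def)
  then show ?thesis by (simp add: bump_def)
qed

lemma bump_above: "u + L + L / D \<le> x \<Longrightarrow> bump D u L x = x"
proof -
  assume "u + L + L / D \<le> x"
  then have "min (x - u) 0 = 0" "min (max (x - u) 0) L = L" "min (max (x - u - L) 0) (L / D) = L / D"
    "max (x - u - L - L / D) 0 = x - u - L - L / D" using L divide_pos_pos[OF L D] by (auto simp: min_def max_def)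
  then show ?thesis using D by (simp add: bump_def)
qed

lemma bump_contract: "u \<le> x \<Longrightarrow> x \<le> u + L \<Longrightarrow> bump D u L x = u + (x - u) / D"
proof -
  assume "u \<le> x" "x \<le> u + L"
  then have "min (x - u) 0 = 0" "min (max (x - u) 0) L = x - u" "min (max (x - u - L) 0) (L / D) = 0"
    "max (x - u - L - L / D) 0 = 0" using L divide_pos_pos[OF L D] by (auto simp: min_def max_def)
  then show ?thesis by (simp add: bump_def)
qed

lemma bump_expand: "u + L \<le> x \<Longrightarrow> x \<le> u + L + L / D \<Longrightarrow> bump D u L x = u + L / D + D * (x - u - L)"
proof -
  assume "u + L \<le> x" "x \<le> u + L + L / D"
  then have "min (x - u) 0 = 0" "min (max (x - u) 0) L = L" "min (max (x - u - L) 0) (L / D) = x - u - L"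
    "max (x - u - L - L / D) 0 = 0" using L divide_pos_pos[OF L D] by (auto simp: min_def max_def)
  then show ?thesis by (simp add: bump_def)
qed

lemma mono_bump: "mono (bump D u L)"
  unfolding mono_def bump_def using D
  by (auto intro!: add_mono min.mono max.mono divide_right_mono mult_left_mono)

lemma continuous_on_bump: "continuous_on UNIV (bump D u L)"
  unfolding bump_def[abs_def] using D by (intro continuous_intros) auto

end

text \<open>bump (1/D) u (L/D) has the same support and the reciprocal slopes in reverse order.\<close>

lemma bump_inverse:
  assumes D: "0 < D" and L: "0 < L" shows "bump (1 / D) u (L / D) (bump D u L x) = x"
proof -
  have D': "0 < 1 / D" and L': "0 < L / D" using D L by simp_all
  consider "x \<le> u" | "u + L + L / D \<le> x" | "u \<le> x" "x \<le> u + L" | "u + L \<le> x" "x \<le> u + L + L / D"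
    by linarith
  then show ?thesis
  proof cases
    case 1
    then show ?thesis using bump_below[OF D L] bump_below[OF D' L'] by simp
  next
    case 2
    then show ?thesis using bump_above[OF D L] bump_above[OF D' L'] D by (simp add: add_ac)
  next
    case 3
    then have "bump D u L x = u + (x - u) / D" by (rule bump_contract[OF D L])
    moreover have "u \<le> u + (x - u) / D" "u + (x - u) / D \<le> u + L / D"
      using 3 D by (simp_all add: divide_right_mono)
    ultimately show ?thesis using bump_contract[OF D' L'] D by simp
  next
    case 4
    define y where "y = u + L / D + D * (x - u - L)"
    have "bump D u L x = y" unfolding y_def using 4 by (rule bump_expand[OF D L])
    moreover have "D * (x - u - L) \<le> D * (L / D)" using 4 D by (intro mult_left_mono) simp_all
    then have "u + L / D \<le> y" "y \<le> u + L / D + L / D / (1 / D)"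
      using 4 D unfolding y_def by simp_all
    then have "bump (1 / D) u (L / D) y = u + L + (x - u - L)"
      using bump_expand[OF D' L'] D by (simp add: y_def)
    ultimately show ?thesis by simp
  qed
qed

lemma bump_maps_unit:
  assumes D: "0 < D" and L: "0 < L" and "0 \<le> u" "u + L + L / D \<le> 1" "x \<in> {0..<1}"
  shows "bump D u L x \<in> {0..<1}"
proof -
  have "bump D u L 0 = 0" "bump D u L 1 = 1"
    using bump_below[OF D L] bump_above[OF D L] assms(3,4) by simp_all
  moreover have "bump D u L 0 \<le> bump D u L x" "bump D u L x \<le> bump D u L 1"
    using mono_bump[OF D L] assms(5) by (simp_all add: monoD)
  moreover have "bump D u L x \<noteq> bump D u L 1"
    using bump_inverse[OF D L, of u] assms(5) by (metis atLeastLessThan_iff less_irrefl)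
  ultimately show ?thesis by simp
qed

lemma bij_betw_bump:
  assumes D: "0 < D" and L: "0 < L" and "0 \<le> u" "u + L + L / D \<le> 1"
  shows "bij_betw (bump D u L) {0..<1} {0..<1}"
proof (rule bij_betw_byWitness[where f' = "bump (1 / D) u (L / D)"])
  have D': "0 < 1 / D" and L': "0 < L / D" and support': "u + L / D + L / D / (1 / D) \<le> 1"
    using assms by (simp_all add: add_ac)
  show "\<forall>y\<in>{0..<1}. bump D u L (bump (1 / D) u (L / D) y) = y"
    using bump_inverse[OF D' L', of u] D by simp
  show "bump (1 / D) u (L / D) ` {0..<1} \<subseteq> {0..<1}"
    using bump_maps_unit[OF D' L' assms(3) support'] by blast
qed (use bump_inverse[OF D L] bump_maps_unit[OF assms] in auto)

lemma continuous_circle_of_support: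
  fixes \<phi> :: "real \<Rightarrow> real"
  assumes cont: "continuous_on UNIV \<phi>" and "0 < c" "c \<le> e" "e < 1"
    and outside: "\<And>x. x \<notin> {c..e} \<Longrightarrow> \<phi> x = x"
  shows "continuous_on UNIV (\<lambda>x. cis (2 * pi * \<phi> (frac x)))"
proof -
  define h where "h y = cis (2 * pi * \<phi> y)" for y
  have "continuous_on UNIV h" unfolding h_def using cont by (intro continuous_intros) auto
  then have h_cont: "isCont h y" for y by (simp add: continuous_on_eq_continuous_at)
  have "isCont (\<lambda>x. h (frac x)) x0" for x0
  proof (cases "x0 \<in> \<int>")
    case False
    then show ?thesis using continuous_at_compose[OF continuous_frac[OF False] h_cont] by (simp add: o_def)
  next
    case True
    then obtain m :: int where m: "x0 = of_int m" by (metis Ints_cases)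
    define r where "r = min c (1 - e)"
    have "0 < r" unfolding r_def using assms by simp
    have "h (frac x) = circle_proj x" if "x \<in> ball x0 r" for x
    proof -
      have dx: "\<bar>x - x0\<bar> < r" using that by (simp add: dist_real_def abs_minus_commute)
      have "frac x = x - x0 \<or> frac x = x - x0 + 1"
        using dx m assms unfolding r_def frac_unique_iff by (cases "x0 \<le> x") (auto simp: algebra_simps)
      then have "frac x \<notin> {c..e}" using dx unfolding r_def by auto
      then show ?thesis using outside circle_proj_frac[of x] by (simp add: h_def circle_proj_def)
    qed
    then have "eventually (\<lambda>x. h (frac x) = circle_proj x) (nhds x0)"
      using eventually_nhds_in_open[of "ball x0 r" x0] \<open>0 < r\<close> by (auto elim: eventually_mono)
    moreover have "isCont circle_proj x0"
      using continuous_on_circle_proj[of UNIV] by (simp add: continuous_on_eq_continuous_at)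
    ultimately show ?thesis using isCont_cong[of "\<lambda>x. h (frac x)" circle_proj x0] by simp
  qed
  then show ?thesis unfolding h_def by (simp add: continuous_on_eq_continuous_at)
qed

lemma affine_partition_bump:
  assumes "0 < d" and u: "u \<in> dadic d" and L: "L \<in> dadic d" "0 < L" and "0 < u" "u + L + L / d < 1"
  shows "\<exists>a n k b. affine_partition d (bump (real d) u L) a n k b"
proof -
  define D where "D = real d"
  define w where "w = u + L + L / D"
  have D: "0 < D" using assms(1) by (simp add: D_def)
  define a where "a i = [0, u, u + L, w, 1] ! i" for i
  define k where "k i = [0, -1, 1, 0::int] ! i" for i
  define b where "b i = [0, u - u / D, u + L / D - D * (u + L), 0] ! i" for i
  have less_4: "i < 4 \<Longrightarrow> i = 0 \<or> i = 1 \<or> i = 2 \<or> i = 3" for i :: nat by auto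
  have "affine_partition d (bump D u L) a 4 k b"
    unfolding affine_partition_def
  proof (intro conjI allI impI ballI)
    show "a 0 = 0" "a 4 = 1" by (simp_all add: a_def)
    show "a i < a (Suc i)" if "i < 4" for i
      using less_4[OF that] assms D \<open>0 < L\<close> unfolding a_def w_def D_def by auto
    have "w \<in> dadic d" "u + L \<in> dadic d"
      unfolding w_def D_def using dadic_add[OF assms(1)] dadic_divide[OF assms(1)] u L by simp_all
    then show "a i \<in> dadic d" if "i \<le> 4" for i
      using u that unfolding a_def by (auto simp: le_Suc_eq numeral_eq_Suc)
    fix i x assume i: "i < 4" and x: "x \<in> {a i..<a (Suc i)}"
    from less_4[OF i] show "bump D u L x = real d powi k i * x + b i"
    proof (elim disjE)
      assume "i = 0"
      then show ?thesis using x bump_below[OF D \<open>0 < L\<close>] by (simp add: a_def k_def b_def)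
    next
      assume "i = 1"
      then have "bump D u L x = u + (x - u) / D" using x bump_contract[OF D \<open>0 < L\<close>] by (simp add: a_def)
      then show ?thesis using \<open>i = 1\<close> D by (simp add: k_def b_def D_def power_int_minus field_simps)
    next
      assume "i = 2"
      then have "bump D u L x = u + L / D + D * (x - u - L)"
        using x bump_expand[OF D \<open>0 < L\<close>] by (simp add: a_def w_def)
      then show ?thesis using \<open>i = 2\<close> by (simp add: k_def b_def D_def algebra_simps)
    next
      assume "i = 3"
      then show ?thesis using x bump_above[OF D \<open>0 < L\<close>] by (simp add: a_def k_def b_def w_def)
    qed
  qed
  then show ?thesis unfolding D_def by blast
qed

lemma bump_in_HT_T:
  assumes "0 < d" and u: "u \<in> dadic d" "0 < u" and L: "L \<in> dadic d" "0 < L" and w: "u + L + L / d < 1"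
  shows "bump (real d) u L \<in> HT_T d"
proof -
  have D: "0 < real d" using assms(1) by simp
  have support: "bump d u L x = x" if "x \<notin> {u..u + L + L / d}" for x
    using that bump_below[OF D \<open>0 < L\<close>] bump_above[OF D \<open>0 < L\<close>] by force
  then have outside: "bump d u L x = x" if "x \<notin> {0..<1}" for x
    using that u w by auto
  have "bump d u L \<in> HT_V d"
    unfolding HT_V_iff
    using bij_betw_bump[OF D \<open>0 < L\<close>] outside affine_partition_bump[OF assms(1) u(1) L u(2) w] u w
    by simp
  moreover have "continuous_on UNIV (\<lambda>x. cis (2 * pi * bump d u L (frac x)))"
    using continuous_circle_of_support[OF continuous_on_bump[OF D \<open>0 < L\<close>] u(2) _ w] support
      \<open>0 < L\<close> D by simp
  ultimately show ?thesis unfolding HT_T_def by simp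
qed

lemma dadic_below:
  assumes "0 < d" obtains c where "c \<in> dadic d" "c \<le> y" "y < c + 1 / real d ^ N"
proof
  define c where "c = of_int \<lfloor>y * real d ^ N\<rfloor> / real d ^ N"
  have pos: "0 < real d ^ N" using assms by simp
  show "c \<in> dadic d" unfolding c_def dadic_def by blast
  show "c \<le> y" unfolding c_def using pos by (simp add: divide_le_eq)
  have "y * real d ^ N < of_int \<lfloor>y * real d ^ N\<rfloor> + 1" by linarith
  then have "y < (of_int \<lfloor>y * real d ^ N\<rfloor> + 1) / real d ^ N" using pos by (simp add: less_divide_eq)
  then show "y < c + 1 / real d ^ N" unfolding c_def by (simp add: add_divide_distrib)
qed

lemma dadic_bump_parameters:
  assumes d: "2 \<le> d" and "0 < \<epsilon>"
  obtains u :: "nat \<Rightarrow> real" and L :: real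
  where "inj u" "\<And>n. u n \<in> dadic d" "L \<in> dadic d" "0 < L"
    "\<And>n. y - \<epsilon> < u n" "\<And>n. u n \<le> y" "\<And>n. y \<le> u n + L" "\<And>n. u n + L + L / d < y + \<epsilon>"
proof -
  define D where "D = real d"
  have D: "2 \<le> D" "0 < d" using d by (simp_all add: D_def)
  obtain N where "(1 / D) ^ N < \<epsilon> / 4" using real_arch_pow_inv[of "\<epsilon> / 4" "1 / D"] D \<open>0 < \<epsilon>\<close> by auto
  define K where "K = 1 / D ^ N"
  have K: "0 < K" "4 * K < \<epsilon>" using \<open>(1 / D) ^ N < \<epsilon> / 4\<close> D unfolding K_def by (auto simp: power_one_over)
  obtain c where c: "c \<in> dadic d" "c \<le> y" "y < c + K"
    using dadic_below[OF D(2), of y N] unfolding K_def D_def by blast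
  define u where "u n = c - K / D ^ n" for n
  define L where "L = 2 * K"
  show ?thesis
  proof
    show "inj u"
    proof
      fix n m assume "u n = u m"
      then have "D ^ n = D ^ m" using K(1) by (simp add: u_def)
      then show "n = m" using D(1) by simp
    qed
    show "u n \<in> dadic d" for n
    proof -
      have "K / D ^ n = real_of_int 1 / real d ^ (N + n)" by (simp add: K_def D_def power_add)
      then show ?thesis unfolding u_def using c(1) dadic_diff[OF D(2)] dadic_divide_power by metis
    qed
    show "L \<in> dadic d" using dadic_divide_power[of 2 d N] by (simp add: L_def K_def D_def)
    show "0 < L" using K(1) by (simp add: L_def)
    fix n
    have "0 < K / D ^ n" "K / D ^ n \<le> K" using K(1) D by (auto simp: divide_le_eq one_le_power)
    moreover have "L / D \<le> K" using K(1) D by (simp add: L_def divide_le_eq)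
    ultimately show "y - \<epsilon> < u n" "u n \<le> y" "y \<le> u n + L" "u n + L + L / d < y + \<epsilon>"
      using c K unfolding u_def L_def D_def by linarith+
  qed
qed

lemma HT_T_moving_family:
  assumes d: "2 \<le> d" and "0 \<le> \<alpha>" "\<alpha> < y" "y < \<beta>" "\<beta> \<le> 1" "p \<noteq> y"
  obtains F :: "nat \<Rightarrow> real \<Rightarrow> real"
  where "\<And>n. F n \<in> HT_T d" "\<And>n z. z \<notin> {\<alpha><..<\<beta>} \<Longrightarrow> F n z = z" "\<And>n. F n p = p"
    "inj (\<lambda>n. F n y)"
proof -
  define \<epsilon> where "\<epsilon> = min \<bar>p - y\<bar> (min (y - \<alpha>) (\<beta> - y))"
  have "0 < \<epsilon>" using assms unfolding \<epsilon>_def by simp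
  show ?thesis
  proof (rule dadic_bump_parameters[OF d \<open>0 < \<epsilon>\<close>, of y])
    fix u :: "nat \<Rightarrow> real" and L :: real
    assume "inj u" and u_dadic: "\<And>n. u n \<in> dadic d" and "L \<in> dadic d" "0 < L"
      and u: "\<And>n. y - \<epsilon> < u n" "\<And>n. u n \<le> y" "\<And>n. y \<le> u n + L" "\<And>n. u n + L + L / d < y + \<epsilon>"
    have D: "0 < real d" "1 < real d" using d by simp_all
    note bump_fixes = bump_below[OF D(1) \<open>0 < L\<close>] bump_above[OF D(1) \<open>0 < L\<close>]
    have support: "\<alpha> < u n" "u n + L + L / d < \<beta>" for n
      using u[of n] unfolding \<epsilon>_def by linarith+
    show ?thesis
    proof (rule that)
      fix n
      have "0 < u n" "u n + L + L / real d < 1" using support[of n] assms(2,5) by linarith+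
      then show "bump d (u n) L \<in> HT_T d"
        by (rule bump_in_HT_T[OF D(1)[simplified] u_dadic _ \<open>L \<in> dadic d\<close> \<open>0 < L\<close>])
      show "bump d (u n) L z = z" if "z \<notin> {\<alpha><..<\<beta>}" for z
      proof -
        from that consider "z \<le> \<alpha>" | "\<beta> \<le> z" by force
        then show ?thesis using support[of n] bump_fixes by cases simp_all
      qed
      have "p \<le> y - \<epsilon> \<or> y + \<epsilon> \<le> p" unfolding \<epsilon>_def by linarith
      then show "bump d (u n) L p = p" using u[of n] bump_fixes by auto
    next
      have "bump d (u n) L y = y / d + (1 - 1 / d) * u n" for n
        using bump_contract[OF D(1) \<open>0 < L\<close> u(2,3)] D(1) by (simp add: field_simps)
      moreover have "1 - 1 / real d \<noteq> 0" using D(2) by simp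
      ultimately show "inj (\<lambda>n. bump d (u n) L y)"
        using \<open>inj u\<close> by (intro injI) (metis add_left_cancel injD mult_left_cancel)
    qed
  qed
qed

lemma HT_V_moved_point_right:
  assumes "f \<in> HT_V d" "x \<in> {0..<1}" "f x \<noteq> x" "x < \<beta>"
  obtains y where "x < y" "y < \<beta>" "f y \<noteq> y"
proof -
  obtain a n k b where "affine_partition d f a n k b" using assms(1) unfolding HT_V_iff by blast
  then obtain i where i: "i < n" "a i \<le> x" "x < a (Suc i)"
    and affine: "\<And>z. z \<in> {a i..<a (Suc i)} \<Longrightarrow> f z = real d powi k i * z + b i"
    using piece_exists[of a x n] assms(2) unfolding affine_partition_def by auto
  define m where "m = min (a (Suc i)) \<beta>"
  define y1 where "y1 = x + (m - x) / 3"
  define y2 where "y2 = x + 2 * (m - x) / 3"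
  have "x < m" using i assms(4) by (simp add: m_def)
  then have y: "x < y1" "y1 < y2" "y2 < m" by (simp_all add: y1_def y2_def field_simps)
  have piece: "z \<in> {a i..<a (Suc i)}" if "x \<le> z" "z < m" for z
    using that i by (simp add: m_def)
  have "f y1 \<noteq> y1 \<or> f y2 \<noteq> y2"
  proof (rule ccontr)
    define s where "s = real d powi k i"
    assume "\<not> (f y1 \<noteq> y1 \<or> f y2 \<noteq> y2)"
    then have "s * y1 + b i = y1" "s * y2 + b i = y2"
      using affine piece y unfolding s_def by (metis less_imp_le less_trans)+
    then have "s * (y2 - y1) = 1 * (y2 - y1)" by (simp add: algebra_simps)
    then have "s = 1" using y by simp
    then have "b i = 0" using \<open>s * y1 + b i = y1\<close> by simp
    then show False using affine[OF piece] assms(3) \<open>s = 1\<close> \<open>x < m\<close> unfolding s_def by simp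
  qed
  moreover have "m \<le> \<beta>" by (simp add: m_def)
  ultimately show ?thesis using that y by (meson less_le_trans less_trans)
qed

section \<open>Centralizers\<close>

lemma centralizer_subset_virtual_centralizer: "centralizer G H \<subseteq> virtual_centralizer G H"
proof
  fix g assume "g \<in> centralizer G H"
  then have "g \<in> carrier G" and "{inv\<^bsub>G\<^esub> h \<otimes>\<^bsub>G\<^esub> g \<otimes>\<^bsub>G\<^esub> h | h. h \<in> H} \<subseteq> {g}"
    unfolding centralizer_def by auto
  then show "g \<in> virtual_centralizer G H"
    unfolding virtual_centralizer_def by (auto intro: finite_subset)
qed

lemma inj_conjugates_fixing_image:
  fixes F :: "nat \<Rightarrow> 'a \<Rightarrow> 'a"
  assumes bij: "\<And>n. bij (F n)" and "inj g" and fixed: "\<And>n. F n (g x) = g x" and "inj (\<lambda>n. F n x)"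
  shows "inj (\<lambda>n. F n \<circ> g \<circ> inv_into UNIV (F n))"
proof (rule injI)
  fix n m assume eq: "F n \<circ> g \<circ> inv_into UNIV (F n) = F m \<circ> g \<circ> inv_into UNIV (F m)"
  have at: "(F k \<circ> g \<circ> inv_into UNIV (F k)) (F k x) = g x" for k
    using bij fixed by (simp add: bij_is_inj)
  have "inj (F m \<circ> g \<circ> inv_into UNIV (F m))"
    using bij \<open>inj g\<close> by (intro inj_compose) (simp_all add: bij_is_inj bij_imp_bij_inv)
  moreover have "(F m \<circ> g \<circ> inv_into UNIV (F m)) (F n x) = (F m \<circ> g \<circ> inv_into UNIV (F m)) (F m x)"
    using at[of n] at[of m] eq by simp
  ultimately have "F n x = F m x" by (rule injD)
  then show "n = m" using \<open>inj (\<lambda>n. F n x)\<close> by (auto simp: inj_def)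
qed

lemma inj_conjugates_fixing_point:
  fixes F :: "nat \<Rightarrow> 'a \<Rightarrow> 'a"
  assumes bij: "\<And>n. bij (F n)" and fixed: "\<And>n. F n x = x" and "inj (\<lambda>n. F n (g x))"
  shows "inj (\<lambda>n. F n \<circ> g \<circ> inv_into UNIV (F n))"
proof (rule injI)
  fix n m assume eq: "F n \<circ> g \<circ> inv_into UNIV (F n) = F m \<circ> g \<circ> inv_into UNIV (F m)"
  have "(F k \<circ> g \<circ> inv_into UNIV (F k)) x = F k (g x)" for k
    using inv_f_eq[OF bij_is_inj[OF bij] fixed] by simp
  then have "F n (g x) = F m (g x)" using eq by metis
  then show "n = m" using \<open>inj (\<lambda>n. F n (g x))\<close> by (auto simp: inj_def)
qed

lemma inj_fixing_outside_maps_into: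
  assumes "inj f" "\<And>x. x \<notin> S \<Longrightarrow> f x = x" "x \<in> S" shows "f x \<in> S"
proof (rule ccontr)
  assume "f x \<notin> S"
  then have "f (f x) = f x" by (rule assms(2))
  then have "f x = x" by (rule injD[OF assms(1)])
  then show False using \<open>f x \<notin> S\<close> assms(3) by simp
qed

lemma comp_commute_of_disjoint_supports:
  assumes f: "inj f" "\<And>x. x \<notin> S \<Longrightarrow> f x = x" and g: "inj g" "\<And>x. x \<in> S \<Longrightarrow> g x = x"
  shows "f \<circ> g = g \<circ> f"
proof
  fix x
  show "(f \<circ> g) x = (g \<circ> f) x"
  proof (cases "x \<in> S")
    case True
    then show ?thesis using g(2) inj_fixing_outside_maps_into[OF f True] by simp
  next
    case False
    then have "g x \<notin> S" using inj_fixing_outside_maps_into[of g "- S" x] g by auto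
    then show ?thesis using f(2) False by simp
  qed
qed

lemma HT_V_conjugates_by_moving_family:
  assumes d: "2 \<le> d" and g: "g \<in> HT_V d" and "0 \<le> \<alpha>" "\<beta> \<le> 1" and x: "x \<in> {\<alpha>..<\<beta>}" "g x \<noteq> x"
  obtains F :: "nat \<Rightarrow> real \<Rightarrow> real"
  where "\<And>n. F n \<in> HT_T d" "\<And>n z. z \<notin> {\<alpha><..<\<beta>} \<Longrightarrow> F n z = z"
    "inj (\<lambda>n. F n \<circ> g \<circ> inv_into UNIV (F n))"
proof -
  obtain y where y: "x < y" "y < \<beta>" "g y \<noteq> y"
    using HT_V_moved_point_right[OF g _ x(2)] x assms(3,4) by auto
  have "\<alpha> < y" using x y by simp
  have bij: "bij f" if "f \<in> HT_T d" for f using that HT_V_bij by (auto simp: HT_T_iff)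
  show ?thesis
  proof (cases "g y \<in> {\<alpha><..<\<beta>}")
    case True
    then have "\<alpha> < g y" "g y < \<beta>" by simp_all
    show ?thesis
    proof (rule HT_T_moving_family[OF d \<open>0 \<le> \<alpha>\<close> \<open>\<alpha> < g y\<close> \<open>g y < \<beta>\<close> \<open>\<beta> \<le> 1\<close>, of y])
      show "y \<noteq> g y" using y(3) by simp
      fix F :: "nat \<Rightarrow> real \<Rightarrow> real"
      assume F: "\<And>n. F n \<in> HT_T d" "\<And>n z. z \<notin> {\<alpha><..<\<beta>} \<Longrightarrow> F n z = z"
        "\<And>n. F n y = y" "inj (\<lambda>n. F n (g y))"
      have inj: "inj (\<lambda>n. F n \<circ> g \<circ> inv_into UNIV (F n))"
        by (rule inj_conjugates_fixing_point[of F y g, OF bij[OF F(1)] F(3,4)])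
      show ?thesis using F(1,2) inj by (rule that)
    qed
  next
    case False
    show ?thesis
    proof (rule HT_T_moving_family[OF d \<open>0 \<le> \<alpha>\<close> \<open>\<alpha> < y\<close> y(2) \<open>\<beta> \<le> 1\<close> y(3)])
      fix F :: "nat \<Rightarrow> real \<Rightarrow> real"
      assume F: "\<And>n. F n \<in> HT_T d" "\<And>n z. z \<notin> {\<alpha><..<\<beta>} \<Longrightarrow> F n z = z"
        "\<And>n. F n (g y) = g y" "inj (\<lambda>n. F n y)"
      have inj: "inj (\<lambda>n. F n \<circ> g \<circ> inv_into UNIV (F n))"
        by (rule inj_conjugates_fixing_image[of F g y, OF bij[OF F(1)] bij_is_inj[OF HT_V_bij[OF g]] F(3,4)])
      show ?thesis using F(1,2) inj by (rule that)
    qed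
  qed
qed

text \<open>Both V_d and T_d satisfy these assumptions.\<close>

locale HT_sandwich =
  fixes d :: nat and M :: "(real \<Rightarrow> real) monoid"
  assumes two_le_d: "2 \<le> d"
    and mult_eq: "monoid.mult M = (\<circ>)" and one_eq: "monoid.one M = id"
    and HT_T_subset: "HT_T d \<subseteq> carrier M" and carrier_subset: "carrier M \<subseteq> HT_V d"
    and inv_into_closed: "f \<in> carrier M \<Longrightarrow> inv_into UNIV f \<in> carrier M"
begin

lemma bij_carrier: "f \<in> carrier M \<Longrightarrow> bij f"
  using carrier_subset HT_V_bij by blast

lemma m_inv_eq:
  assumes "h \<in> carrier M" shows "inv\<^bsub>M\<^esub> h = inv_into UNIV h"
  unfolding m_inv_def
proof (rule the_equality)
  have "h \<circ> inv_into UNIV h = id" "inv_into UNIV h \<circ> h = id"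
    using bij_carrier[OF assms] by (simp_all add: bij_is_surj bij_is_inj flip: surj_iff inj_iff)
  then show "inv_into UNIV h \<in> carrier M \<and> h \<otimes>\<^bsub>M\<^esub> inv_into UNIV h = \<one>\<^bsub>M\<^esub> \<and> inv_into UNIV h \<otimes>\<^bsub>M\<^esub> h = \<one>\<^bsub>M\<^esub>"
    using inv_into_closed[OF assms] by (simp add: mult_eq one_eq)
next
  fix y assume "y \<in> carrier M \<and> h \<otimes>\<^bsub>M\<^esub> y = \<one>\<^bsub>M\<^esub> \<and> y \<otimes>\<^bsub>M\<^esub> h = \<one>\<^bsub>M\<^esub>"
  then have "y \<circ> h = id" "h \<circ> y = id" by (simp_all add: mult_eq one_eq)
  then show "y = inv_into UNIV h" by (metis inv_unique_comp)
qed

lemma conjugate_eq: "h \<in> carrier M \<Longrightarrow> inv\<^bsub>M\<^esub> h \<otimes>\<^bsub>M\<^esub> g \<otimes>\<^bsub>M\<^esub> h = inv_into UNIV h \<circ> g \<circ> h"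
  by (simp add: m_inv_eq mult_eq)

lemma fix_on_subset_centralizer:
  assumes "{0..<1} \<subseteq> A \<union> J" shows "fix_on (carrier M) J \<subseteq> centralizer M (fix_on (carrier M) A)"
proof
  fix g assume "g \<in> fix_on (carrier M) J"
  then have g: "g \<in> carrier M" "\<And>x. x \<in> J \<Longrightarrow> g x = x" unfolding fix_on_def by auto
  have "inv\<^bsub>M\<^esub> h \<otimes>\<^bsub>M\<^esub> g \<otimes>\<^bsub>M\<^esub> h = g" if "h \<in> fix_on (carrier M) A" for h
  proof -
    have h: "h \<in> carrier M" "\<And>x. x \<in> A \<Longrightarrow> h x = x" using that unfolding fix_on_def by auto
    have "h x = x" if "x \<notin> J" for x
      using that assms h HT_V_fixes_outside[of h d x] carrier_subset by blast
    then have "h \<circ> g = g \<circ> h"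
      using comp_commute_of_disjoint_supports[of h J g] bij_carrier g h by (simp add: bij_is_inj)
    then have "inv_into UNIV h \<circ> g \<circ> h = inv_into UNIV h \<circ> h \<circ> g" by (simp add: comp_assoc)
    also have "\<dots> = g" using bij_carrier[OF h(1)] by (simp add: fun_eq_iff bij_is_inj)
    finally show ?thesis using conjugate_eq[OF h(1)] by simp
  qed
  then show "g \<in> centralizer M (fix_on (carrier M) A)" unfolding centralizer_def using g(1) by blast
qed

lemma conjugate_by_HT_T:
  assumes F: "F \<in> HT_T d" "\<And>z. z \<notin> S \<Longrightarrow> F z = z" and "A \<inter> S = {}"
  shows "F \<circ> g \<circ> inv_into UNIV F \<in> {inv\<^bsub>M\<^esub> h \<otimes>\<^bsub>M\<^esub> g \<otimes>\<^bsub>M\<^esub> h | h. h \<in> fix_on (carrier M) A}"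
proof -
  have "F \<in> carrier M" "bij F" using F(1) HT_T_subset bij_carrier by auto
  moreover have "inv_into UNIV F x = x" if "x \<in> A" for x
    using inv_f_eq[OF bij_is_inj[OF \<open>bij F\<close>]] F(2) that \<open>A \<inter> S = {}\<close> by blast
  ultimately have "inv_into UNIV F \<in> fix_on (carrier M) A"
    using inv_into_closed unfolding fix_on_def by blast
  moreover have "inv\<^bsub>M\<^esub> (inv_into UNIV F) \<otimes>\<^bsub>M\<^esub> g \<otimes>\<^bsub>M\<^esub> inv_into UNIV F = F \<circ> g \<circ> inv_into UNIV F"
    using conjugate_eq inv_into_closed \<open>F \<in> carrier M\<close> inv_inv_eq[OF \<open>bij F\<close>] by simp
  ultimately show ?thesis by force
qed

lemma virtual_centralizer_subset_fix_on:
  assumes "0 \<le> \<alpha>" "\<beta> \<le> 1" "A \<inter> {\<alpha><..<\<beta>} = {}"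
  shows "virtual_centralizer M (fix_on (carrier M) A) \<subseteq> fix_on (carrier M) {\<alpha>..<\<beta>}"
proof
  fix g assume "g \<in> virtual_centralizer M (fix_on (carrier M) A)"
  then have g: "g \<in> carrier M"
    and finite: "finite {inv\<^bsub>M\<^esub> h \<otimes>\<^bsub>M\<^esub> g \<otimes>\<^bsub>M\<^esub> h | h. h \<in> fix_on (carrier M) A}"
    unfolding virtual_centralizer_def by auto
  show "g \<in> fix_on (carrier M) {\<alpha>..<\<beta>}"
  proof (rule ccontr)
    assume "g \<notin> fix_on (carrier M) {\<alpha>..<\<beta>}"
    then obtain x where x: "x \<in> {\<alpha>..<\<beta>}" "g x \<noteq> x" using g unfolding fix_on_def by auto
    have gV: "g \<in> HT_V d" using g carrier_subset by blast
    show False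
    proof (rule HT_V_conjugates_by_moving_family[OF two_le_d gV assms(1,2) x])
      fix F :: "nat \<Rightarrow> real \<Rightarrow> real"
      assume F: "\<And>n. F n \<in> HT_T d" "\<And>n z. z \<notin> {\<alpha><..<\<beta>} \<Longrightarrow> F n z = z"
        and inj: "inj (\<lambda>n. F n \<circ> g \<circ> inv_into UNIV (F n))"
      have "range (\<lambda>n. F n \<circ> g \<circ> inv_into UNIV (F n))
          \<subseteq> {inv\<^bsub>M\<^esub> h \<otimes>\<^bsub>M\<^esub> g \<otimes>\<^bsub>M\<^esub> h | h. h \<in> fix_on (carrier M) A}"
        using conjugate_by_HT_T[OF F(1) F(2) assms(3)] by blast
      then have "finite (range (\<lambda>n. F n \<circ> g \<circ> inv_into UNIV (F n)))" using finite by (rule finite_subset)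
      then have "finite (UNIV :: nat set)" using inj by (rule finite_imageD)
      then show False by simp
    qed
  qed
qed

lemma virtual_centralizer_fix_on_eq:
  assumes "0 \<le> \<alpha>" "\<beta> \<le> 1" "{0..<1} \<subseteq> A \<union> {\<alpha>..<\<beta>}" "A \<inter> {\<alpha><..<\<beta>} = {}"
  shows "virtual_centralizer M (fix_on (carrier M) A) = centralizer M (fix_on (carrier M) A)
    \<and> centralizer M (fix_on (carrier M) A) = fix_on (carrier M) {\<alpha>..<\<beta>}"
proof -
  note fix_C = fix_on_subset_centralizer[OF assms(3)]
    and C_VC = centralizer_subset_virtual_centralizer
    and VC_fix = virtual_centralizer_subset_fix_on[OF assms(1,2,4)]
  show ?thesis
    using subset_antisym[OF order.trans[OF VC_fix fix_C] C_VC]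
      subset_antisym[OF order.trans[OF C_VC VC_fix] fix_C]
    by (rule conjI)
qed

end

theorem lemma5p9:
  fixes d :: nat
  assumes "d \<ge> 2"
  shows
   "virtual_centralizer (Vgrp d) (fix_on (HT_V d) {0..<1/d})
       = centralizer (Vgrp d) (fix_on (HT_V d) {0..<1/d})
    \<and> centralizer (Vgrp d) (fix_on (HT_V d) {0..<1/d}) = fix_on (HT_V d) {1/d..<1}
    \<and> virtual_centralizer (Vgrp d) (fix_on (HT_V d) {1/d..<1})
       = centralizer (Vgrp d) (fix_on (HT_V d) {1/d..<1})
    \<and> centralizer (Vgrp d) (fix_on (HT_V d) {1/d..<1}) = fix_on (HT_V d) {0..<1/d}
    \<and> virtual_centralizer (Tgrp d) (fix_on (HT_T d) {0..<1/d})
       = centralizer (Tgrp d) (fix_on (HT_T d) {0..<1/d})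
    \<and> centralizer (Tgrp d) (fix_on (HT_T d) {0..<1/d}) = fix_on (HT_T d) {1/d..<1}
    \<and> virtual_centralizer (Tgrp d) (fix_on (HT_T d) {1/d..<1})
       = centralizer (Tgrp d) (fix_on (HT_T d) {1/d..<1})
    \<and> centralizer (Tgrp d) (fix_on (HT_T d) {1/d..<1}) = fix_on (HT_T d) {0..<1/d}"
proof -
  have "0 < d" using assms by simp
  have V: "HT_sandwich d (Vgrp d)"
    using assms HT_V_inv[OF \<open>0 < d\<close>] by unfold_locales (auto simp: Vgrp_def HT_T_def)
  have T: "HT_sandwich d (Tgrp d)"
    using assms HT_T_inv[OF \<open>0 < d\<close>] by unfold_locales (auto simp: Tgrp_def HT_T_def)
  have le: "0 \<le> 1 / real d" "1 / real d \<le> 1" using assms by simp_all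
  then have cover: "{0..<1} \<subseteq> {0..<1/d} \<union> {1/d..<1}" "{0..<1} \<subseteq> {1/d..<1} \<union> {0..<1/d}"
    and disjoint: "{0..<1/d} \<inter> {1/d<..<1} = {}" "{1/d..<1} \<inter> {0<..<1/d} = {}"
    by auto
  have
    "virtual_centralizer M (fix_on (carrier M) {0..<1/d}) = centralizer M (fix_on (carrier M) {0..<1/d})
       \<and> centralizer M (fix_on (carrier M) {0..<1/d}) = fix_on (carrier M) {1/d..<1}"
    "virtual_centralizer M (fix_on (carrier M) {1/d..<1}) = centralizer M (fix_on (carrier M) {1/d..<1})
       \<and> centralizer M (fix_on (carrier M) {1/d..<1}) = fix_on (carrier M) {0..<1/d}"
    if "HT_sandwich d M" for M
    using HT_sandwich.virtual_centralizer_fix_on_eq[OF that le(1) order.refl cover(1) disjoint(1)]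
      HT_sandwich.virtual_centralizer_fix_on_eq[OF that order.refl le(2) cover(2) disjoint(2)]
    by simp_all
  note eqs = this[OF V] this[OF T]
  have "carrier (Vgrp d) = HT_V d" "carrier (Tgrp d) = HT_T d"
    by (simp_all add: Vgrp_def Tgrp_def)
  then show ?thesis using eqs by simp
qed

end
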